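(* Let $M\subset\mathbb R^n$ be a regular (embedded) submanifold of dimension $m<n$, let $X_e:\mathbb R^n\times\mathbb R^k\to\mathbb R^n$ be smooth with $X_e(x,u)\in T_xM$ for all $x\in M$, $u\in\mathbb R^k$, and let $\tilde V:\mathbb R^n\to\mathbb R_{\ge 0}$ be a smooth function such that $M=\tilde V^{-1}(0)$ and $\nabla\tilde V(x)\cdot X_e(x,u)=0$ for all $x\in\mathbb R^n$, $u\in\mathbb R^k$. Consider the control system $$\tilde\Sigma_{\mathbb R^n}:\quad \dot x=X_e(x,u)-\nabla\tilde V(x),\qquad x\in\mathbb R^n,\ u\in\mathbb R^k.$$ Suppose there are positive numbers $b$ and $r$ such that $b\,\tilde V(x)\le\|\nabla\tilde V(x)\|^2$ for all $x\in\tilde V^{-1}([0,r))$. Then $\tilde V^{-1}([0,r))$ is positively invariant for $\tilde\Sigma_{\mathbb R^n}$, and every trajectory $x(t)$, $t\ge 0$, of $\tilde\Sigma_{\mathbb R^n}$ starting in $\tilde V^{-1}([0,r))$ converges to $M$ as $t\to\infty$. In particular, $\tilde V(x(t))\le\tilde V(x(0))e^{-bt}$ for all $t\ge0$ and all $x(0)\in\tilde V^{-1}([0,r))$.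
   Context: $\|\cdot\|$ is the Euclidean norm and $\nabla$ the Euclidean gradient. A trajectory (flow) of $\tilde\Sigma_{\mathbb R^n}$ is a solution $x(t)$ of the differential equation driven by some (arbitrary) control signal $u(t)$; statements for $t\to\infty$ concern solutions defined for all $t\ge 0$. "Converges to $M$" means that the Euclidean distance from $x(t)$ to $M$ tends to $0$. *)

theory Defs
  imports "HOL-Analysis.Analysis"
begin

(* C^k on an open set S of a finite-dimensional space: all iterated directional
   derivatives up to order k exist as Frechet derivatives and are continuous. *)
primrec Ck_on :: "nat \<Rightarrow> 'a::euclidean_space set \<Rightarrow> ('a \<Rightarrow> 'b::real_normed_vector) \<Rightarrow> bool" where
  "Ck_on 0 S f \<longleftrightarrow> continuous_on S f"
| "Ck_on (Suc k) S f \<longleftrightarrow>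
     (\<forall>x\<in>S. f differentiable (at x)) \<and>
     (\<forall>v. Ck_on k S (\<lambda>x. frechet_derivative f (at x) v))"

definition smooth_on :: "'a::euclidean_space set \<Rightarrow> ('a \<Rightarrow> 'b::real_normed_vector) \<Rightarrow> bool" where
  "smooth_on S f \<longleftrightarrow> open S \<and> (\<forall>k. Ck_on k S f)"

definition gradient :: "('a::real_inner \<Rightarrow> real) \<Rightarrow> 'a \<Rightarrow> 'a" where
  "gradient f x = (THE D. GDERIV f x :> D)"

lemma gradient_eqI:
  assumes "GDERIV f x :> D"
  shows "gradient f x = D"
  unfolding gradient_def
proof (rule the_equality)
  fix E assume "GDERIV f x :> E"
  then have "(\<lambda>h. h \<bullet> E) = (\<lambda>h. h \<bullet> D)"
    using assms unfolding gderiv_def by (rule has_derivative_unique)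
  then have "(E - D) \<bullet> E = (E - D) \<bullet> D" by (rule fun_cong)
  then have "(E - D) \<bullet> (E - D) = 0" by (simp only: inner_diff_right diff_self)
  then show "E = D" by simp
qed (rule assms)

lemma GDERIV_gradient:
  fixes f :: "'a::euclidean_space \<Rightarrow> real"
  assumes "f differentiable (at x)"
  shows "GDERIV f x :> gradient f x"
proof -
  obtain f' where f': "(f has_derivative f') (at x)"
    using assms unfolding differentiable_def by blast
  then interpret linear f' by (rule has_derivative_linear)
  have "f' = (\<lambda>h. h \<bullet> adjoint f' 1)"
    using adjoint_works[OF linear_axioms, of _ 1] by auto
  with f' have D: "GDERIV f x :> adjoint f' 1"
    unfolding gderiv_def by simp
  show ?thesis unfolding gradient_eqI[OF D] by (rule D)
qed

(* Every point has a slice chart: a local diffeomorphism phi of the ambient space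
   mapping M to an m-dimensional linear subspace. *)
definition embedded_submanifold :: "nat \<Rightarrow> 'a::euclidean_space set \<Rightarrow> bool" where
  "embedded_submanifold m M \<longleftrightarrow>
     (\<forall>p\<in>M. \<exists>U W (\<phi> :: 'a \<Rightarrow> 'a) \<psi> L.
        p \<in> U \<and> smooth_on U \<phi> \<and> smooth_on W \<psi> \<and> homeomorphism U W \<phi> \<psi> \<and>
        subspace L \<and> dim L = m \<and> \<phi> ` (U \<inter> M) = W \<inter> L)"

(* Velocities at p of smooth curves lying in M. *)
definition tangent_space :: "'a::euclidean_space set \<Rightarrow> 'a \<Rightarrow> 'a set" where
  "tangent_space M p =
     {v. \<exists>\<gamma> e. 0 < e \<and> smooth_on {-e<..<e} \<gamma> \<and> \<gamma> ` {-e<..<e} \<subseteq> M \<and> \<gamma> 0 = p \<and>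
           (\<gamma> has_vector_derivative v) (at (0::real))}"

(* x solves x' = F x u on the time interval I (starting at time 0) for the control signal u.
   To admit discontinuous controls, for which x need not be differentiable everywhere, the
   equation is stated in integrated form. No regularity of u is assumed. Since has_integral is
   the Henstock-Kurzweil integral, this comprises both classical solutions, differentiable
   everywhere or up to finitely many switching times (see the two lemmas below), and
   Caratheodory solutions, where the integral exists as a Lebesgue integral. *)
definition trajectory_on ::
  "('a::euclidean_space \<Rightarrow> 'b \<Rightarrow> 'a) \<Rightarrow> real set \<Rightarrow> (real \<Rightarrow> 'b) \<Rightarrow> (real \<Rightarrow> 'a) \<Rightarrow> bool" where
  "trajectory_on F I u x \<longleftrightarrow>
     is_interval I \<and> 0 \<in> I \<and> I \<subseteq> {0..} \<and>
     (\<forall>t\<in>I. ((\<lambda>s. F (x s) (u s)) has_integral (x t - x 0)) {0..t})"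

lemma trajectory_onI_classical:
  assumes I: "is_interval I" "0 \<in> I" "I \<subseteq> {0..}"
    and ode: "\<And>t. t \<in> I \<Longrightarrow> (x has_vector_derivative F (x t) (u t)) (at t within I)"
  shows "trajectory_on F I u x"
  unfolding trajectory_on_def
proof (intro conjI ballI I)
  fix t assume t: "t \<in> I"
  have sub: "{0..t} \<subseteq> I"
    using I(1,2) t unfolding is_interval_1 by fastforce
  show "((\<lambda>s. F (x s) (u s)) has_integral (x t - x 0)) {0..t}"
  proof (rule fundamental_theorem_of_calculus)
    show "0 \<le> t" using t I(3) by auto
    show "(x has_vector_derivative F (x s) (u s)) (at s within {0..t})" if "s \<in> {0..t}" for s
      using has_vector_derivative_within_subset[OF ode sub] sub that by auto
  qed
qed

lemma trajectory_onI_switching: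
  assumes I: "is_interval I" "0 \<in> I" "I \<subseteq> {0..}"
    and cont: "continuous_on I x"
    and fin: "\<And>t. t \<in> I \<Longrightarrow> finite (S \<inter> {0..t})"
    and ode: "\<And>t. t \<in> interior I - S \<Longrightarrow> (x has_vector_derivative F (x t) (u t)) (at t)"
  shows "trajectory_on F I u x"
  unfolding trajectory_on_def
proof (intro conjI ballI I)
  fix t assume t: "t \<in> I"
  have sub: "{0..t} \<subseteq> I"
    using I(1,2) t unfolding is_interval_1 by fastforce
  have int: "{0<..<t} \<subseteq> interior I"
    by (rule interior_maximal) (use sub in auto)
  show "((\<lambda>s. F (x s) (u s)) has_integral (x t - x 0)) {0..t}"
  proof (rule fundamental_theorem_of_calculus_interior_strong[OF fin[OF t]])
    show "0 \<le> t" using t I(3) by auto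
    show "continuous_on {0..t} x" using cont sub by (rule continuous_on_subset)
    show "(x has_vector_derivative F (x s) (u s)) (at s)" if "s \<in> {0<..<t} - S \<inter> {0..t}" for s
      using ode int that by auto
  qed
qed

definition positively_invariant ::
  "('a::euclidean_space \<Rightarrow> 'b \<Rightarrow> 'a) \<Rightarrow> 'a set \<Rightarrow> bool" where
  "positively_invariant F S \<longleftrightarrow>
     (\<forall>I u x. trajectory_on F I u x \<longrightarrow> x 0 \<in> S \<longrightarrow> (\<forall>t\<in>I. x t \<in> S))"

(* M is required to be nonempty because infdist to the empty set is 0 by convention. *)
definition converges_to_set :: "(real \<Rightarrow> 'a::metric_space) \<Rightarrow> 'a set \<Rightarrow> bool" where
  "converges_to_set x M \<longleftrightarrow> M \<noteq> {} \<and> ((\<lambda>t. infdist (x t) M) \<longlongrightarrow> 0) at_top"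

definition extended_system ::
  "('a::euclidean_space \<Rightarrow> 'b \<Rightarrow> 'a) \<Rightarrow> ('a \<Rightarrow> real) \<Rightarrow> 'a \<Rightarrow> 'b \<Rightarrow> 'a" where
  "extended_system X V = (\<lambda>x u. X x u - gradient V x)"

end

theory Submission
  imports Defs
begin

text \<open>
  Along a trajectory the function \<open>V\<close> dissipates: since \<open>\<nabla>V\<close> is orthogonal to \<open>X\<close>, formally
  \<open>d/dt V(x) = -\<parallel>\<nabla>V(x)\<parallel>\<^sup>2\<close>, whatever the control does. So \<open>V\<close> does not increase, which is
  invariance of the sublevel set, and there the gradient inequality turns the identity into
  \<open>d/dt V(x) \<le> -b V(x)\<close>, which is exponential decay.

  Two points need care. The first is the chain rule. A trajectory is only an indefinite
  Henstock-Kurzweil integral: it need be neither differentiable everywhere nor of bounded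
  variation. The chain rule is therefore proved in integrated form, directly on Riemann sums, in
  \<open>has_integral_chain_rule_GDERIV\<close>. The resulting integrand \<open>\<parallel>\<nabla>V(x)\<parallel>\<^sup>2\<close> is continuous,
  as it does not involve the control; so \<open>t \<mapsto> V(x(t))\<close> is continuously differentiable although
  \<open>x\<close> may not be, and the decay estimate is then elementary calculus.

  The second is that \<open>V(x(t)) \<rightarrow> 0\<close> does not by itself bring \<open>x(t)\<close> close to the zero set, since
  \<open>x\<close> may be unbounded. But the gradient inequality says that \<open>\<surd>V\<close> has slope at least
  \<open>\<surd>b / 2\<close> wherever \<open>0 < V < r\<close>, and a nonnegative function with slope bounded below by a constant
  reaches zero within a distance proportional to its value. This gives
  \<open>dist(x, M) \<le> const \<cdot> \<surd>V(x)\<close>, proved in \<open>distance_bound_of_gradient_inequality\<close> by a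
  variational argument.
\<close>

section \<open>A chain rule for Henstock-Kurzweil primitives\<close>

text \<open>
  Both endpoints vary here, so that an increment over an interval can be compared with the
  derivative at a tag inside the interval, without splitting the interval at the tag. This is where
  continuity of the derivative enters: \<open>V - \<nabla>V(p) \<bullet> _\<close> has small gradient near \<open>p\<close>.
\<close>
lemma strict_differentiability_GDERIV:
  fixes V :: "'a::euclidean_space \<Rightarrow> real"
  assumes deriv: "\<And>y. GDERIV V y :> g y" and cont: "isCont g p" and "0 < \<eta>"
  obtains \<rho> where "0 < \<rho>"
    "\<And>y z. y \<in> ball p \<rho> \<Longrightarrow> z \<in> ball p \<rho> \<Longrightarrow> \<bar>V z - V y - (z - y) \<bullet> g p\<bar> \<le> \<eta> * norm (z - y)"
proof -
  obtain \<rho> where \<rho>: "0 < \<rho>" "\<And>y. dist y p < \<rho> \<Longrightarrow> dist (g y) (g p) < \<eta>"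
    using cont \<open>0 < \<eta>\<close> unfolding continuous_at_eps_delta by metis
  have "\<bar>V z - V y - (z - y) \<bullet> g p\<bar> \<le> \<eta> * norm (z - y)"
    if "y \<in> ball p \<rho>" "z \<in> ball p \<rho>" for y z
  proof -
    have "norm ((\<lambda>w. V w - w \<bullet> g p) z - (\<lambda>w. V w - w \<bullet> g p) y) \<le> \<eta> * norm (z - y)"
    proof (rule differentiable_bound[where S = "ball p \<rho>" and f' = "\<lambda>w h. h \<bullet> g w - h \<bullet> g p"])
      fix w assume w: "w \<in> ball p \<rho>"
      have "(V has_derivative (\<lambda>h. h \<bullet> g w)) (at w within ball p \<rho>)"
        using deriv[of w] unfolding gderiv_def by (rule has_derivative_at_withinI)
      then show "((\<lambda>w. V w - w \<bullet> g p) has_derivative (\<lambda>h. h \<bullet> g w - h \<bullet> g p)) (at w within ball p \<rho>)"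
        by (auto intro!: derivative_eq_intros)
      have "norm (g w - g p) \<le> \<eta>"
        using \<rho>(2)[of w] w by (simp add: dist_commute dist_norm norm_minus_commute less_imp_le)
      then have "\<bar>h \<bullet> (g w - g p)\<bar> \<le> \<eta> * norm h" for h
        using Cauchy_Schwarz_ineq2[of h "g w - g p"]
        by (smt (verit) mult.commute mult_right_mono norm_ge_zero)
      then show "onorm (\<lambda>h. h \<bullet> g w - h \<bullet> g p) \<le> \<eta>"
        by (intro onorm_bound) (use \<open>0 < \<eta>\<close> in \<open>auto simp: inner_diff_right\<close>)
    qed (use that in auto)
    then show ?thesis by (simp add: inner_diff_left algebra_simps)
  qed
  with \<rho>(1) show thesis by (rule that)
qed

lemma continuous_on_has_integral_primitive:
  fixes f x :: "real \<Rightarrow> 'a::euclidean_space"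
  assumes prim: "\<And>t. t \<in> {a..b} \<Longrightarrow> (f has_integral (x t - x a)) {a..t}"
  shows "continuous_on {a..b} x"
proof (cases "a \<le> b")
  case True
  then have "f integrable_on {a..b}"
    using prim[of b] by (auto intro: has_integral_integrable)
  then have "continuous_on {a..b} (\<lambda>t. x a + integral {a..t} f)"
    by (intro continuous_intros indefinite_integral_continuous_1)
  moreover have "x a + integral {a..t} f = x t" if "t \<in> {a..b}" for t
    using integral_unique[OF prim[OF that]] by simp
  ultimately show ?thesis by (rule continuous_on_eq)
qed simp

text \<open>
  On a cell \<open>[c, d]\<close> with tag \<open>\<xi>\<close>, write \<open>\<Delta>x = x(d) - x(c)\<close> and let
  \<open>r = (d - c) f(\<xi>) - \<Delta>x\<close> be the local error of the Riemann sum for \<open>f\<close>. Then the local error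
  of the Riemann sum for \<open>f \<bullet> g(x)\<close> splits as
  \<open>r \<bullet> g(x(\<xi>)) + (\<Delta>x \<bullet> g(x(\<xi>)) - \<Delta>V)\<close>. Henstock's lemma bounds the sum of all
  \<open>\<parallel>r\<parallel>\<close>, and \<open>g\<close> is bounded along \<open>x\<close>, which handles the first part. The second part is at most
  \<open>\<eta> \<parallel>\<Delta>x\<parallel> \<le> \<eta> (d - c) \<parallel>f(\<xi>)\<parallel> + \<eta> \<parallel>r\<parallel>\<close>. The sum of the \<open>\<parallel>\<Delta>x\<parallel>\<close> may be unbounded,
  but a gauge may depend on the tag: choosing \<open>\<eta> = e / (1 + \<parallel>f(\<xi>)\<parallel>)\<close> makes the first
  summand at most \<open>e (d - c)\<close>.
\<close>
lemma has_integral_chain_rule_GDERIV: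
  fixes V :: "'a::euclidean_space \<Rightarrow> real" and f x :: "real \<Rightarrow> 'a"
  assumes deriv: "\<And>y. GDERIV V y :> g y" and cont: "continuous_on UNIV g"
    and "a \<le> b"
    and prim: "\<And>t. t \<in> {a..b} \<Longrightarrow> (f has_integral (x t - x a)) {a..t}"
  shows "((\<lambda>s. f s \<bullet> g (x s)) has_integral (V (x b) - V (x a))) {a..b}"
proof -
  have f_int: "f integrable_on {a..b}"
    using prim[of b] \<open>a \<le> b\<close> by (auto intro: has_integral_integrable)
  have x_eq: "x t = x a + integral {a..t} f" if "t \<in> {a..b}" for t
    using integral_unique[OF prim[OF that]] by simp
  have x_cont: "continuous_on {a..b} x"
    using prim by (rule continuous_on_has_integral_primitive)
  have incr: "integral {c..d} f = x d - x c" if "a \<le> c" "c \<le> d" "d \<le> b" for c d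
  proof -
    have "f integrable_on {a..d}"
      using f_int by (rule integrable_on_subinterval) (use that in auto)
    from Henstock_Kurzweil_Integration.integral_combine[OF that(1,2) this]
    show ?thesis using x_eq[of c] x_eq[of d] that by (simp add: algebra_simps)
  qed
  have "compact ((\<lambda>s. g (x s)) ` {a..b})"
    by (intro compact_continuous_image continuous_on_compose2[OF cont x_cont]) auto
  then obtain G where G: "0 < G" "\<And>s. s \<in> {a..b} \<Longrightarrow> norm (g (x s)) \<le> G"
    using compact_imp_bounded bounded_pos by (metis imageI)
  show ?thesis
    unfolding has_integral_real
  proof (intro allI impI)
    fix \<epsilon> :: real assume "0 < \<epsilon>"
    \<comment> \<open>The total error will be at most \<open>e (b - a) + (e + G) e'\<close>; each summand gets half of \<open>\<epsilon>\<close>.\<close>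
    define e where "e = \<epsilon> / (2 * (b - a + 1))"
    have "0 < e" using \<open>0 < \<epsilon>\<close> \<open>a \<le> b\<close> by (simp add: e_def)
    have e_bound: "e * (b - a) \<le> \<epsilon> / 2"
      using \<open>0 < \<epsilon>\<close> \<open>a \<le> b\<close> by (simp add: e_def field_simps)
    define e' where "e' = \<epsilon> / (2 * (e + G))"
    have "0 < e'" using \<open>0 < \<epsilon>\<close> \<open>0 < e\<close> G(1) by (simp add: e'_def)
    have e'_bound: "(e + G) * e' = \<epsilon> / 2"
      using \<open>0 < e\<close> G(1) by (simp add: e'_def field_simps)
    have "f integrable_on cbox a b" using f_int by simp
    then obtain \<gamma> where \<gamma>: "gauge \<gamma>"
      and hen: "\<And>p. p tagged_partial_division_of cbox a b \<Longrightarrow> \<gamma> fine p \<Longrightarrow>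
        (\<Sum>(\<xi>,K)\<in>p. norm (measure lborel K *\<^sub>R f \<xi> - integral K f)) < e'"
      using \<open>0 < e'\<close> by (rule Henstock_lemma) blast
    have "\<exists>\<delta>>0. \<forall>c d. \<xi> \<in> {a..b} \<longrightarrow> c \<in> {a..b} \<longrightarrow> d \<in> {a..b} \<longrightarrow>
        \<bar>c - \<xi>\<bar> < \<delta> \<longrightarrow> \<bar>d - \<xi>\<bar> < \<delta> \<longrightarrow>
        \<bar>V (x d) - V (x c) - (x d - x c) \<bullet> g (x \<xi>)\<bar> \<le> e / (1 + norm (f \<xi>)) * norm (x d - x c)" for \<xi>
    proof (cases "\<xi> \<in> {a..b}")
      case True
      have "isCont g (x \<xi>)"
        using cont by (simp add: continuous_on_eq_continuous_at)
      moreover have "0 < e / (1 + norm (f \<xi>))"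
        using \<open>0 < e\<close> by (simp add: add_pos_nonneg)
      ultimately obtain \<rho> where \<rho>: "0 < \<rho>"
        "\<And>y z. y \<in> ball (x \<xi>) \<rho> \<Longrightarrow> z \<in> ball (x \<xi>) \<rho> \<Longrightarrow>
          \<bar>V z - V y - (z - y) \<bullet> g (x \<xi>)\<bar> \<le> e / (1 + norm (f \<xi>)) * norm (z - y)"
        using strict_differentiability_GDERIV[OF deriv] by metis
      obtain \<delta> where "0 < \<delta>" "\<And>s. s \<in> {a..b} \<Longrightarrow> dist s \<xi> < \<delta> \<Longrightarrow> dist (x s) (x \<xi>) < \<rho>"
        using x_cont True \<rho>(1) unfolding continuous_on_iff by metis
      then have "x s \<in> ball (x \<xi>) \<rho>" if "s \<in> {a..b}" "\<bar>s - \<xi>\<bar> < \<delta>" for s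
        using that by (simp add: dist_real_def dist_commute[of "x \<xi>"])
      with \<open>0 < \<delta>\<close> show ?thesis
        by (intro exI[of _ \<delta>]) (blast intro: \<rho>(2))
    qed (auto intro: exI[of _ 1])
    then obtain \<delta> where \<delta>: "\<And>\<xi>. 0 < \<delta> \<xi>"
      "\<And>\<xi> c d. \<xi> \<in> {a..b} \<Longrightarrow> c \<in> {a..b} \<Longrightarrow> d \<in> {a..b} \<Longrightarrow> \<bar>c - \<xi>\<bar> < \<delta> \<xi> \<Longrightarrow> \<bar>d - \<xi>\<bar> < \<delta> \<xi> \<Longrightarrow>
        \<bar>V (x d) - V (x c) - (x d - x c) \<bullet> g (x \<xi>)\<bar> \<le> e / (1 + norm (f \<xi>)) * norm (x d - x c)"
      by metis
    show "\<exists>\<gamma>. gauge \<gamma> \<and> (\<forall>p. p tagged_division_of {a..b} \<and> \<gamma> fine p \<longrightarrow>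
        norm ((\<Sum>(\<xi>,K)\<in>p. measure lborel K *\<^sub>R (f \<xi> \<bullet> g (x \<xi>))) - (V (x b) - V (x a))) < \<epsilon>)"
    proof (intro exI[of _ "\<lambda>\<xi>. \<gamma> \<xi> \<inter> ball \<xi> (\<delta> \<xi>)"] conjI allI impI)
      show "gauge (\<lambda>\<xi>. \<gamma> \<xi> \<inter> ball \<xi> (\<delta> \<xi>))"
        using \<gamma> \<delta>(1) by (intro gauge_Int gauge_ball_dependent) auto
      fix p assume "p tagged_division_of {a..b} \<and> (\<lambda>\<xi>. \<gamma> \<xi> \<inter> ball \<xi> (\<delta> \<xi>)) fine p"
      then have p: "p tagged_division_of {a..b}" and fine: "(\<lambda>\<xi>. \<gamma> \<xi> \<inter> ball \<xi> (\<delta> \<xi>)) fine p"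
        by auto
      have hen_p: "(\<Sum>(\<xi>,K)\<in>p. norm (measure lborel K *\<^sub>R f \<xi> - integral K f)) < e'"
        using fine p by (intro hen) (auto simp: fine_Int tagged_division_of_def)
      have cell: "\<bar>measure lborel K *\<^sub>R (f \<xi> \<bullet> g (x \<xi>)) - (V (x (Sup K)) - V (x (Inf K)))\<bar>
          \<le> e * measure lborel K + (e + G) * norm (measure lborel K *\<^sub>R f \<xi> - integral K f)"
        if \<xi>K: "(\<xi>, K) \<in> p" for \<xi> K
      proof -
        obtain c d where K: "K = {c..d}"
          using tagged_division_ofD(4)[OF p \<xi>K] by auto
        have \<xi>: "\<xi> \<in> K" and sub: "K \<subseteq> {a..b}"
          using tagged_division_ofD(2,3)[OF p \<xi>K] by auto
        then have cd: "a \<le> c" "c \<le> d" "d \<le> b" "c \<le> \<xi>" "\<xi> \<le> d" using K by auto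
        have "K \<subseteq> ball \<xi> (\<delta> \<xi>)" using fine \<xi>K by (auto simp: fine_def)
        moreover have "c \<in> K" "d \<in> K" using K cd by auto
        ultimately have "\<bar>c - \<xi>\<bar> < \<delta> \<xi>" "\<bar>d - \<xi>\<bar> < \<delta> \<xi>"
          by (auto simp: dist_real_def subset_iff abs_minus_commute)
        define r where "r = (d - c) *\<^sub>R f \<xi> - (x d - x c)"
        have r: "measure lborel K *\<^sub>R f \<xi> - integral K f = r"
          using incr[of c d] cd K by (simp add: r_def)
        define \<eta> where "\<eta> = e / (1 + norm (f \<xi>))"
        have \<eta>: "0 \<le> \<eta>" "\<eta> \<le> e" "\<eta> * norm (f \<xi>) \<le> e"
          using \<open>0 < e\<close> by (auto simp: \<eta>_def field_simps add_pos_nonneg)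
        have "\<bar>V (x d) - V (x c) - (x d - x c) \<bullet> g (x \<xi>)\<bar> \<le> \<eta> * norm (x d - x c)"
          using cd \<open>\<bar>c - \<xi>\<bar> < \<delta> \<xi>\<close> \<open>\<bar>d - \<xi>\<bar> < \<delta> \<xi>\<close> unfolding \<eta>_def by (intro \<delta>(2)) auto
        also have "\<dots> \<le> \<eta> * ((d - c) * norm (f \<xi>) + norm r)"
        proof (rule mult_left_mono[OF _ \<eta>(1)])
          have "x d - x c = (d - c) *\<^sub>R f \<xi> - r" by (simp add: r_def)
          then show "norm (x d - x c) \<le> (d - c) * norm (f \<xi>) + norm r"
            using norm_triangle_ineq4[of "(d - c) *\<^sub>R f \<xi>" r] cd by simp
        qed
        also have "\<dots> \<le> e * (d - c) + e * norm r"
          using mult_right_mono[OF \<eta>(3), of "d - c"] mult_right_mono[OF \<eta>(2), of "norm r"] cd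
          by (simp add: algebra_simps)
        finally have "\<bar>V (x d) - V (x c) - (x d - x c) \<bullet> g (x \<xi>)\<bar> \<le> e * (d - c) + e * norm r" .
        moreover have "\<bar>r \<bullet> g (x \<xi>)\<bar> \<le> norm r * G"
          using Cauchy_Schwarz_ineq2[of r "g (x \<xi>)"] G(2)[of \<xi>] cd
          by (smt (verit) atLeastAtMost_iff mult_left_mono norm_ge_zero)
        moreover have "(d - c) * (f \<xi> \<bullet> g (x \<xi>)) = r \<bullet> g (x \<xi>) + (x d - x c) \<bullet> g (x \<xi>)"
          by (simp add: r_def inner_diff_left)
        ultimately have "\<bar>(d - c) * (f \<xi> \<bullet> g (x \<xi>)) - (V (x d) - V (x c))\<bar>
            \<le> e * (d - c) + (e + G) * norm r"
          by (simp add: algebra_simps)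
        then show ?thesis unfolding r using K cd by simp
      qed
      \<comment> \<open>The increments of \<open>V \<circ> x\<close> over the cells telescope, so the cell errors add up to the total error.\<close>
      have tel: "(\<Sum>(\<xi>,K)\<in>p. V (x (Sup K)) - V (x (Inf K))) = V (x b) - V (x a)"
        using additive_tagged_division_1[OF \<open>a \<le> b\<close> p, of "\<lambda>t. V (x t)"] .
      have "(\<Sum>(\<xi>,K)\<in>p. measure lborel K *\<^sub>R (f \<xi> \<bullet> g (x \<xi>))) - (V (x b) - V (x a))
          = (\<Sum>(\<xi>,K)\<in>p. measure lborel K *\<^sub>R (f \<xi> \<bullet> g (x \<xi>)) - (V (x (Sup K)) - V (x (Inf K))))"
        unfolding tel[symmetric] by (simp add: sum_subtractf split_def)
      also have "norm \<dots> \<le> (\<Sum>(\<xi>,K)\<in>p. e * measure lborel K + (e + G) * norm (measure lborel K *\<^sub>R f \<xi> - integral K f))"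
        by (rule sum_norm_le) (use cell in auto)
      also have "\<dots> = e * (\<Sum>(\<xi>,K)\<in>p. measure lborel K)
          + (e + G) * (\<Sum>(\<xi>,K)\<in>p. norm (measure lborel K *\<^sub>R f \<xi> - integral K f))"
        by (simp add: sum.distrib sum_distrib_left split_def)
      also have "(\<Sum>(\<xi>,K)\<in>p. measure lborel K) = b - a"
        using additive_content_tagged_division[of p a b] p \<open>a \<le> b\<close> by simp
      also have "e * (b - a) + (e + G) * (\<Sum>(\<xi>,K)\<in>p. norm (measure lborel K *\<^sub>R f \<xi> - integral K f))
          < \<epsilon> / 2 + \<epsilon> / 2"
        using e_bound mult_strict_left_mono[OF hen_p, of "e + G"] \<open>0 < e\<close> G(1)
        unfolding e'_bound by simp
      finally show "norm ((\<Sum>(\<xi>,K)\<in>p. measure lborel K *\<^sub>R (f \<xi> \<bullet> g (x \<xi>))) - (V (x b) - V (x a))) < \<epsilon>"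
        by simp
    qed
  qed
qed

section \<open>Distance to the zero set under a gradient inequality\<close>

text \<open>
  As in Ekeland's variational principle, let \<open>q\<close> minimise \<open>\<surd>V + c dist(p, _)\<close>; the second term
  confines the search to a compact ball. If \<open>V(q) > 0\<close>, then \<open>\<surd>V\<close> is differentiable at \<open>q\<close>, and
  minimality bounds its slope \<open>\<parallel>\<nabla>V(q)\<parallel> / (2 \<surd>V(q))\<close> by \<open>c\<close>; but the gradient inequality says that
  the slope is at least \<open>\<surd>b / 2 > c\<close>. So \<open>V(q) = 0\<close>, and comparing \<open>q\<close> with \<open>p\<close> gives the
  distance bound.
\<close>
lemma distance_bound_of_gradient_inequality:
  fixes V :: "'a::euclidean_space \<Rightarrow> real"
  assumes deriv: "\<And>y. GDERIV V y :> g y" and nonneg: "\<And>y. 0 \<le> V y"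
    and "0 < b" and PL: "\<And>y. V y < r \<Longrightarrow> b * V y \<le> (norm (g y))\<^sup>2"
    and "V p < r" and "0 < c" and "4 * c\<^sup>2 < b"
  obtains q where "V q = 0" "c * dist p q \<le> sqrt (V p)"
proof -
  have V_cont: "continuous_on UNIV V"
    using deriv by (intro continuous_at_imp_continuous_on ballI)
      (auto simp: gderiv_def intro: has_derivative_continuous)
  define h where "h = (\<lambda>y. sqrt (V y) + c * dist p y)"
  \<comment> \<open>Outside the ball of radius \<open>R\<close> the distance term alone exceeds the value at \<open>p\<close>.\<close>
  define R where "R = sqrt (V p) / c"
  have p_ball: "p \<in> cball p R" using nonneg[of p] \<open>0 < c\<close> by (simp add: R_def)
  have "\<exists>q\<in>cball p R. \<forall>y\<in>cball p R. h q \<le> h y"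
  proof (rule continuous_attains_inf)
    show "cball p R \<noteq> {}" using p_ball by auto
    show "continuous_on (cball p R) h"
      unfolding h_def
      by (intro continuous_intros continuous_on_subset[OF V_cont] subset_UNIV)
  qed simp
  then obtain q where q: "q \<in> cball p R" "\<And>y. y \<in> cball p R \<Longrightarrow> h q \<le> h y" by blast
  have qp: "h q \<le> sqrt (V p)"
    using q(2)[OF p_ball] by (simp add: h_def)
  have q_min: "h q \<le> h y" for y
  proof (cases "y \<in> cball p R")
    case False
    then have "sqrt (V p) \<le> c * dist p y"
      using \<open>0 < c\<close> by (simp add: R_def field_simps)
    then show ?thesis using qp nonneg[of y] by (simp add: h_def) (smt (verit) real_sqrt_ge_zero)
  qed (rule q(2))
  have ekeland: "sqrt (V q) \<le> sqrt (V y) + c * dist q y" for y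
    using q_min[of y] dist_triangle[of p y q] \<open>0 < c\<close>
      mult_left_mono[OF dist_triangle[of p y q], of c]
    by (simp add: h_def algebra_simps)
  have "V q = 0"
  proof (rule ccontr)
    assume "V q \<noteq> 0"
    with nonneg[of q] have Vq: "0 < V q" by simp
    have "0 \<le> c * dist p q" using \<open>0 < c\<close> by simp
    then have "sqrt (V q) \<le> sqrt (V p)" using qp unfolding h_def by linarith
    then have "V q < r" using \<open>V p < r\<close> by simp
    define n where "n = norm (g q)"
    \<comment> \<open>\<open>D\<close> is the derivative at \<open>s = 0\<close> of \<open>\<surd>V(q - s \<nabla>V(q)) + c s \<parallel>\<nabla>V(q)\<parallel>\<close>: steepest descent would
      beat the minimiser \<open>q\<close>.\<close>
    define D where "D = c * n - n\<^sup>2 / (2 * sqrt (V q))"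
    have low: "b * V q \<le> n\<^sup>2" using PL[OF \<open>V q < r\<close>] by (simp add: n_def)
    have "D < 0"
    proof -
      have "0 < n\<^sup>2" using low \<open>0 < b\<close> Vq by (smt (verit) mult_pos_pos)
      then have "0 < n" by (simp add: n_def)
      have "(2 * c * sqrt (V q))\<^sup>2 = 4 * c\<^sup>2 * V q"
        using Vq by (simp add: power_mult_distrib)
      also have "\<dots> < b * V q"
        using \<open>4 * c\<^sup>2 < b\<close> Vq by simp
      also note low
      finally have "(2 * c * sqrt (V q))\<^sup>2 < n\<^sup>2" .
      then have "2 * c * sqrt (V q) < n"
        by (rule power_less_imp_less_base) (use \<open>0 < n\<close> in simp)
      then have "n * (2 * c * sqrt (V q)) < n * n" using \<open>0 < n\<close> by simp
      then show ?thesis using Vq by (simp add: D_def field_simps power2_eq_square)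
    qed
    moreover have "((\<lambda>s. sqrt (V (q - s *\<^sub>R g q)) + c * s * n) has_real_derivative D) (at 0)"
    proof -
      have "((\<lambda>s. q - s *\<^sub>R g q) has_derivative (\<lambda>s. - (s *\<^sub>R g q))) (at 0)"
        by (auto intro!: derivative_eq_intros)
      moreover have "(V has_derivative (\<lambda>h. h \<bullet> g q)) (at (q - 0 *\<^sub>R g q))"
        using deriv[of q] by (simp add: gderiv_def)
      ultimately have "((\<lambda>s. V (q - s *\<^sub>R g q)) has_derivative (\<lambda>s. - (s *\<^sub>R g q) \<bullet> g q)) (at 0)"
        by (rule has_derivative_compose)
      then have "((\<lambda>s. V (q - s *\<^sub>R g q)) has_real_derivative - n\<^sup>2) (at 0)"
        unfolding has_field_derivative_def
        by (rule has_derivative_eq_rhs) (simp add: fun_eq_iff n_def power2_norm_eq_inner)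
      then show ?thesis
        using Vq by (auto intro!: derivative_eq_intros simp: D_def field_simps)
    qed
    ultimately obtain \<delta> where \<delta>: "0 < \<delta>"
      "\<And>s. 0 < s \<Longrightarrow> s < \<delta> \<Longrightarrow> sqrt (V (q - s *\<^sub>R g q)) + c * s * n < sqrt (V q)"
      using DERIV_neg_dec_right[of "\<lambda>s. sqrt (V (q - s *\<^sub>R g q)) + c * s * n" D 0] by auto
    have "sqrt (V (q - (\<delta> / 2) *\<^sub>R g q)) + c * (\<delta> / 2) * n < sqrt (V q)"
      using \<delta>(1) by (intro \<delta>(2)) auto
    moreover have "dist q (q - (\<delta> / 2) *\<^sub>R g q) = \<delta> / 2 * n"
      using \<delta>(1) by (simp add: dist_norm n_def)
    ultimately show False using ekeland[of "q - (\<delta> / 2) *\<^sub>R g q"] by simp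
  qed
  with qp show thesis by (intro that[of q]) (auto simp: h_def)
qed

section \<open>Energy balance along trajectories\<close>

text \<open>
  Continuity of \<open>d\<close> makes \<open>w\<close> differentiable with \<open>w' = -d\<close>, so that Gronwall's argument applies:
  \<open>w(t) exp(b t)\<close> is nonincreasing.
\<close>
lemma exponential_decay_of_integral_dissipation:
  fixes w d :: "real \<Rightarrow> real"
  assumes "0 \<le> T" and cont: "continuous_on {0..T} d"
    and int: "\<And>t. t \<in> {0..T} \<Longrightarrow> (d has_integral (w 0 - w t)) {0..t}"
    and diss: "\<And>t. t \<in> {0..T} \<Longrightarrow> b * w t \<le> d t"
  shows "w T \<le> w 0 * exp (- b * T)"
proof -
  have deriv: "(w has_real_derivative - d t) (at t within {0..T})" if "t \<in> {0..T}" for t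
  proof -
    have w_eq: "w s = w 0 - integral {0..s} d" if "s \<in> {0..T}" for s
      using integral_unique[OF int[OF that]] by simp
    have "((\<lambda>s. w 0 - integral {0..s} d) has_vector_derivative - d t) (at t within {0..T})"
      using integral_has_vector_derivative[OF cont that] by (auto intro!: derivative_eq_intros)
    then have "(w has_vector_derivative - d t) (at t within {0..T})"
      by (intro has_vector_derivative_transform[OF that w_eq])
    then show ?thesis by (simp add: has_real_derivative_iff_has_vector_derivative)
  qed
  have "(\<lambda>t. w t * exp (b * t)) T \<le> (\<lambda>t. w t * exp (b * t)) 0"
  proof (rule DERIV_nonpos_imp_decreasing_open[OF \<open>0 \<le> T\<close>])
    show "continuous_on {0..T} (\<lambda>t. w t * exp (b * t))"
      by (intro continuous_intros DERIV_continuous_on[OF deriv])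
    fix t assume t: "0 < t" "t < T"
    have "(w has_real_derivative - d t) (at t)"
      using deriv[of t] t by (simp add: at_within_Icc_at)
    then have "((\<lambda>t. w t * exp (b * t)) has_real_derivative (b * w t - d t) * exp (b * t)) (at t)"
      by (auto intro!: derivative_eq_intros simp: algebra_simps)
    moreover have "(b * w t - d t) * exp (b * t) \<le> 0"
      using diss[of t] t by (simp add: mult_nonpos_nonneg)
    ultimately show "\<exists>y. ((\<lambda>t. w t * exp (b * t)) has_real_derivative y) (at t) \<and> y \<le> 0"
      by blast
  qed
  then have "w T * exp (b * T) * exp (- b * T) \<le> w 0 * exp (- b * T)"
    by (intro mult_right_mono) auto
  then show ?thesis by (simp add: mult.assoc flip: exp_add)
qed

lemma smooth_on_imp_GDERIV_gradient:
  fixes V :: "'a::euclidean_space \<Rightarrow> real"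
  assumes "smooth_on UNIV V"
  shows "GDERIV V y :> gradient V y"
proof -
  have "Ck_on (Suc 0) UNIV V" using assms unfolding smooth_on_def by blast
  then show ?thesis by (intro GDERIV_gradient) simp
qed

lemma smooth_on_imp_continuous_gradient:
  fixes V :: "'a::euclidean_space \<Rightarrow> real"
  assumes "smooth_on UNIV V"
  shows "continuous_on UNIV (gradient V)"
proof -
  have "Ck_on (Suc 0) UNIV V" using assms unfolding smooth_on_def by blast
  then have "continuous_on UNIV (\<lambda>y. frechet_derivative V (at y) v)" for v by simp
  moreover have "frechet_derivative V (at y) = (\<lambda>v. v \<bullet> gradient V y)" for y
    using smooth_on_imp_GDERIV_gradient[OF assms, of y]
    unfolding gderiv_def by (rule frechet_derivative_at[symmetric])
  ultimately have "continuous_on UNIV (\<lambda>y. gradient V y \<bullet> v)" for v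
    by (simp add: inner_commute)
  then show ?thesis by (subst continuous_on_componentwise) simp
qed

text \<open>
  The control drops out of the dissipation, so the integrand is continuous however irregular the control
  signal \<open>u\<close> is. A trajectory on an arbitrary interval \<open>I\<close> is considered on
  \<open>{0..T} \<subseteq> I\<close> for each \<open>T \<in> I\<close>, as solutions may escape in finite time.
\<close>
lemma trajectory_on_energy_balance:
  fixes V :: "'a::euclidean_space \<Rightarrow> real"
  assumes V: "smooth_on UNIV V"
    and orth: "\<And>x u. gradient V x \<bullet> X x u = 0"
    and traj: "trajectory_on (extended_system X V) I u x" and "T \<in> I"
  shows "0 \<le> T" and "continuous_on {0..T} (\<lambda>s. (norm (gradient V (x s)))\<^sup>2)"
    and "\<And>t. t \<in> {0..T} \<Longrightarrow>
      ((\<lambda>s. (norm (gradient V (x s)))\<^sup>2) has_integral (V (x 0) - V (x t))) {0..t}"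
proof -
  let ?F = "\<lambda>s. extended_system X V (x s) (u s)"
  have I: "is_interval I" "0 \<in> I" "I \<subseteq> {0..}"
    and sol: "\<And>t. t \<in> I \<Longrightarrow> (?F has_integral (x t - x 0)) {0..t}"
    using traj unfolding trajectory_on_def by auto
  show "0 \<le> T" using I(3) \<open>T \<in> I\<close> by auto
  have sub: "{0..T} \<subseteq> I"
    using I(1,2) \<open>T \<in> I\<close> unfolding is_interval_1 by fastforce
  have x_cont: "continuous_on {0..T} x"
    by (rule continuous_on_has_integral_primitive[where f = ?F]) (use sol sub in blast)
  show "continuous_on {0..T} (\<lambda>s. (norm (gradient V (x s)))\<^sup>2)"
    by (intro continuous_intros
      continuous_on_compose2[OF smooth_on_imp_continuous_gradient[OF V] x_cont]) auto
  fix t assume t: "t \<in> {0..T}"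
  have "((\<lambda>s. ?F s \<bullet> gradient V (x s)) has_integral (V (x t) - V (x 0))) {0..t}"
  proof (rule has_integral_chain_rule_GDERIV)
    show "(?F has_integral (x s - x 0)) {0..s}" if "s \<in> {0..t}" for s
      using that t sub by (intro sol) auto
  qed (use t in \<open>auto intro: smooth_on_imp_GDERIV_gradient smooth_on_imp_continuous_gradient V\<close>)
  moreover have "?F s \<bullet> gradient V (x s) = - (norm (gradient V (x s)))\<^sup>2" for s
    using orth[of "x s" "u s"] inner_commute[of "X (x s) (u s)" "gradient V (x s)"]
    by (simp add: extended_system_def inner_diff_left power2_norm_eq_inner)
  ultimately have "((\<lambda>s. - (norm (gradient V (x s)))\<^sup>2) has_integral (V (x t) - V (x 0))) {0..t}"
    by simp
  from has_integral_neg[OF this]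
  show "((\<lambda>s. (norm (gradient V (x s)))\<^sup>2) has_integral (V (x 0) - V (x t))) {0..t}"
    by simp
qed

section \<open>Convergence to the submanifold\<close>

theorem theorem1:
  fixes M :: "(real ^ 'n) set"
    and X :: "real ^ 'n \<Rightarrow> real ^ 'k \<Rightarrow> real ^ 'n"
    and V :: "real ^ 'n \<Rightarrow> real"
    and m :: nat and b r :: real
  assumes "embedded_submanifold m M" and "m < CARD('n)"
    and "smooth_on UNIV (\<lambda>(x, u). X x u)"
    and "\<And>x u. x \<in> M \<Longrightarrow> X x u \<in> tangent_space M x"
    and "smooth_on UNIV V" and "\<And>x. 0 \<le> V x"
    and "M = V -` {0}"
    and "\<And>x u. gradient V x \<bullet> X x u = 0"
    and "0 < b" and "0 < r"
    and "\<And>x. x \<in> V -` {0..<r} \<Longrightarrow> b * V x \<le> (norm (gradient V x))\<^sup>2"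
  shows "positively_invariant (extended_system X V) (V -` {0..<r}) \<and>
    (\<forall>u x. trajectory_on (extended_system X V) {0..} u x \<longrightarrow> x 0 \<in> V -` {0..<r} \<longrightarrow>
       converges_to_set x M) \<and>
    (\<forall>u x. trajectory_on (extended_system X V) {0..} u x \<longrightarrow> x 0 \<in> V -` {0..<r} \<longrightarrow>
       (\<forall>t\<ge>0. V (x t) \<le> V (x 0) * exp (- b * t)))"
proof -
  note energy = trajectory_on_energy_balance[OF assms(5,8)]
  note deriv = smooth_on_imp_GDERIV_gradient[OF assms(5)]
  have sub: "x t \<in> V -` {0..<r}"
    if "trajectory_on (extended_system X V) I u x" "x 0 \<in> V -` {0..<r}" "t \<in> I" for I u x t
  proof -
    have "t \<in> {0..t}" using energy(1)[OF that(1,3)] by simp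
    from energy(3)[OF that(1,3) this] have "0 \<le> V (x 0) - V (x t)"
      by (rule has_integral_nonneg) simp
    then show ?thesis using that(2) assms(6)[of "x t"] by auto
  qed
  have decay: "V (x t) \<le> V (x 0) * exp (- b * t)"
    if x: "trajectory_on (extended_system X V) {0..} u x" "x 0 \<in> V -` {0..<r}" and "0 \<le> t" for u x t
  proof (rule exponential_decay_of_integral_dissipation[where w = "\<lambda>t. V (x t)"])
    have "t \<in> {0..}" using \<open>0 \<le> t\<close> by simp
    from energy(2,3)[OF x(1) this]
    show "continuous_on {0..t} (\<lambda>s. (norm (gradient V (x s)))\<^sup>2)"
      and "\<And>s. s \<in> {0..t} \<Longrightarrow>
        ((\<lambda>s. (norm (gradient V (x s)))\<^sup>2) has_integral (V (x 0) - V (x s))) {0..s}" .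
    show "b * V (x s) \<le> (norm (gradient V (x s)))\<^sup>2" if "s \<in> {0..t}" for s
      using sub[OF x, of s] that by (intro assms(11)) auto
  qed fact
  have conv: "converges_to_set x M"
    if x: "trajectory_on (extended_system X V) {0..} u x" "x 0 \<in> V -` {0..<r}" for u x
  proof -
    \<comment> \<open>Any \<open>c\<close> strictly between \<open>0\<close> and \<open>\<surd>b / 2\<close>, the lower bound for the slope of \<open>\<surd>V\<close>, would do.\<close>
    define c where "c = sqrt b / 4"
    have c: "0 < c" "4 * c\<^sup>2 < b" using \<open>0 < b\<close> by (auto simp: c_def power_divide)
    have near: "\<exists>q\<in>M. c * dist (x t) q \<le> sqrt (V (x t))" if "0 \<le> t" for t
    proof -
      have "V (x t) < r" using sub[OF x, of t] that by auto
      moreover have "b * V y \<le> (norm (gradient V y))\<^sup>2" if "V y < r" for y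
        using that assms(6)[of y] by (intro assms(11)) auto
      ultimately obtain q where "V q = 0" "c * dist (x t) q \<le> sqrt (V (x t))"
        using distance_bound_of_gradient_inequality[OF deriv assms(6) \<open>0 < b\<close> _ _ c] by metis
      then show ?thesis using \<open>M = V -` {0}\<close> by auto
    qed
    have bound: "infdist (x t) M \<le> sqrt (V (x 0) * exp (- b * t)) / c" if "0 \<le> t" for t
    proof -
      obtain q where "q \<in> M" and q: "c * dist (x t) q \<le> sqrt (V (x t))"
        using near[OF \<open>0 \<le> t\<close>] by blast
      have "dist (x t) q \<le> sqrt (V (x t)) / c"
        using q c(1) by (simp add: field_simps)
      also have "\<dots> \<le> sqrt (V (x 0) * exp (- b * t)) / c"
        using decay[OF x that] c(1) by (intro divide_right_mono) auto
      finally show ?thesis using infdist_le[OF \<open>q \<in> M\<close>, of "x t"] by simp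
    qed
    have "((\<lambda>t. exp (- b * t)) \<longlongrightarrow> 0) at_top"
      by (rule filterlim_compose[OF exp_at_bot filterlim_tendsto_neg_mult_at_bot])
        (use \<open>0 < b\<close> in \<open>auto intro: filterlim_ident\<close>)
    then have "((\<lambda>t. sqrt (V (x 0) * exp (- b * t)) / c) \<longlongrightarrow> sqrt (V (x 0) * 0) / c) at_top"
      by (intro tendsto_intros) (use c(1) in auto)
    then have upper_lim: "((\<lambda>t. sqrt (V (x 0) * exp (- b * t)) / c) \<longlongrightarrow> 0) at_top" by simp
    have upper: "\<forall>\<^sub>F t in at_top. infdist (x t) M \<le> sqrt (V (x 0) * exp (- b * t)) / c"
      using bound by (rule eventually_at_top_linorderI)
    have lower: "\<forall>\<^sub>F t in at_top. 0 \<le> infdist (x t) M"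
      by (simp add: infdist_nonneg)
    have "((\<lambda>t. infdist (x t) M) \<longlongrightarrow> 0) at_top"
      by (rule tendsto_sandwich[OF lower upper tendsto_const upper_lim])
    \<comment> \<open>The distance bound produces a zero of \<open>V\<close>, which shows that \<open>M\<close> is inhabited.\<close>
    moreover have "M \<noteq> {}" using near[of 0] by auto
    ultimately show ?thesis by (simp add: converges_to_set_def)
  qed
  show ?thesis
    unfolding positively_invariant_def using sub decay conv by blast
qed

end
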